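(* For every path connected topological space $X$ and any $x\in X$, $$\pi_1^{sg}(X,x)\leqslant\pi_1^{qs}(X,x)\leqslant\pi_1^{sp}(X,x),$$ i.e. each is a subgroup of the next inside $\pi_1(X,x)$.
   Context: All spaces are assumed path connected. $I=[0,1]$, $\dot I=\{0,1\}$; $\simeq$ rel $\dot I$ denotes homotopy of paths relative to endpoints, and $[f]$ is the homotopy class of a path $f$ rel $\dot I$. $*$ is concatenation of paths, $g^{-1}$ is the reverse path, $c_x$ is the constant path at $x$, and $P(X,x)$ is the set of all paths in $X$ with initial point $x$. Closeness: let $f,g:I\to X$ be paths with $f(0)=g(0)$ and $f(1)=g(1)$. We say $f$ is homotopically close to $g$ rel $\dot I$ (written $f\xrightarrow{close} g$ rel $\dot I$) if for every partition $0=t_0<t_1<\cdots<t_n=1$ and every sequence of open sets $U_1,\ldots,U_n$ of $X$ with $g([t_{i-1},t_i])\subset U_i$ for all $i$, there is a path $\gamma$ with $\gamma([t_{i-1},t_i])\subset U_i$ for $1\le i\le n$, $\gamma(t_i)=g(t_i)$ for $0\le i\le n$, and $\gamma\simeq f$ rel $\dot I$. Small loop group: $\pi_1^s(X,x)=\{[f]\in\pi_1(X,x): f\xrightarrow{close} c_x \text{ rel } \dot I\}$ (equivalently, classes of loops $f$ such that every open neighborhood of $x$ contains a loop at $x$ homotopic to $f$ rel $\dot I$). Small generated subgroup: $\pi_1^{sg}(X,x)$ is the subgroup of $\pi_1(X,x)$ generated by $\{[\beta*\alpha*\beta^{-1}] : \beta\in P(X,x),\ [\alpha]\in\pi_1^s(X,\beta(1))\}$.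 Quasi-small loop group: $\pi_1^{qs}(X,x)=\{[f]\in\pi_1(X,x): f\xrightarrow{close} f' \text{ rel } \dot I \text{ for some } f'\in[c_x]\}$. Spanier group: for an open cover $\mathcal U$ of $X$, $\pi(\mathcal U,x)\le\pi_1(X,x)$ is the subgroup of all homotopy classes having representatives of the form $\prod_{j=1}^n u_j*v_j*u_j^{-1}$, where each $u_j$ is a path starting at $x$ and each $v_j$ is a loop based at $u_j(1)$ inside some member of $\mathcal U$. The (unbased) Spanier group $\pi_1^{sp}(X,x)$ is the inverse limit of the groups $\pi(\mathcal U,x)$ over all open covers directed by refinement (with inclusions as bonding maps), i.e. the intersection $\bigcap_{\mathcal U}\pi(\mathcal U,x)$. *)

theory Defs
  imports "HOL-Analysis.Analysis" "HOL-Algebra.Generated_Groups"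
begin

text \<open>
  A space \<open>X\<close> is a subset of an arbitrary topological type, with the subspace topology; taking
  \<open>X = UNIV\<close> gives the type itself. Paths are functions on \<open>real\<close> of which only the values
  on \<open>{0..1}\<close> matter: all notions below are insensitive to the values elsewhere.
\<close>

definition paths_from :: "'a::topological_space set \<Rightarrow> 'a \<Rightarrow> (real \<Rightarrow> 'a) set" where
  "paths_from X x = {f. path f \<and> path_image f \<subseteq> X \<and> pathstart f = x}"

definition loops_at :: "'a::topological_space set \<Rightarrow> 'a \<Rightarrow> (real \<Rightarrow> 'a) set" where
  "loops_at X x = {f \<in> paths_from X x. pathfinish f = x}"

abbreviation const_path :: "'a \<Rightarrow> real \<Rightarrow> 'a" where
  "const_path x \<equiv> (\<lambda>_. x)"

definition path_class :: "'a::topological_space set \<Rightarrow> (real \<Rightarrow> 'a) \<Rightarrow> (real \<Rightarrow> 'a) set" where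
  "path_class X f = {g. homotopic_paths X f g}"

text \<open>
  The product of two classes is the union of the classes of all products of representatives. It is
  \<open>path_class X (f +++ g)\<close> for any choice of the representatives \<open>f\<close> and \<open>g\<close>; see
  \<open>fundamental_group_mult\<close> below.
\<close>

definition fundamental_group ::
    "'a::topological_space set \<Rightarrow> 'a \<Rightarrow> (real \<Rightarrow> 'a) set monoid" where
  "fundamental_group X x =
     \<lparr>carrier = path_class X ` loops_at X x,
      mult = (\<lambda>A B. \<Union>f\<in>A. \<Union>g\<in>B. path_class X (f +++ g)),
      one = path_class X (const_path x)\<rparr>"

text \<open>The open set \<open>U i\<close> belongs to the subinterval from \<open>t i\<close> to \<open>t (i + 1)\<close>, for \<open>i < n\<close>.\<close>

definition homotopically_close ::
    "'a::topological_space set \<Rightarrow> (real \<Rightarrow> 'a) \<Rightarrow> (real \<Rightarrow> 'a) \<Rightarrow> bool" where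
  "homotopically_close X f g \<longleftrightarrow>
     path f \<and> path_image f \<subseteq> X \<and> path g \<and> path_image g \<subseteq> X \<and>
     pathstart f = pathstart g \<and> pathfinish f = pathfinish g \<and>
     (\<forall>(n::nat) (t::nat \<Rightarrow> real) (U::nat \<Rightarrow> 'a set).
        t 0 = 0 \<longrightarrow> t n = 1 \<longrightarrow> (\<forall>i<n. t i < t (Suc i)) \<longrightarrow>
        (\<forall>i<n. openin (top_of_set X) (U i) \<and> g ` {t i..t (Suc i)} \<subseteq> U i) \<longrightarrow>
        (\<exists>\<gamma>. path \<gamma> \<and> path_image \<gamma> \<subseteq> X \<and>
             (\<forall>i<n. \<gamma> ` {t i..t (Suc i)} \<subseteq> U i) \<and>
             (\<forall>i\<le>n. \<gamma> (t i) = g (t i)) \<and>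
             homotopic_paths X \<gamma> f))"

definition small_loop_group ::
    "'a::topological_space set \<Rightarrow> 'a \<Rightarrow> (real \<Rightarrow> 'a) set set" where
  "small_loop_group X x =
     {path_class X f | f. f \<in> loops_at X x \<and> homotopically_close X f (const_path x)}"

definition small_generated_subgroup ::
    "'a::topological_space set \<Rightarrow> 'a \<Rightarrow> (real \<Rightarrow> 'a) set set" where
  "small_generated_subgroup X x =
     generate (fundamental_group X x)
       {path_class X (\<beta> +++ \<alpha> +++ reversepath \<beta>) | \<beta> \<alpha>.
          \<beta> \<in> paths_from X x \<and> \<alpha> \<in> loops_at X (pathfinish \<beta>) \<and>
          path_class X \<alpha> \<in> small_loop_group X (pathfinish \<beta>)}"

definition quasi_small_loop_group ::
    "'a::topological_space set \<Rightarrow> 'a \<Rightarrow> (real \<Rightarrow> 'a) set set" where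
  "quasi_small_loop_group X x =
     {path_class X f | f. f \<in> loops_at X x \<and>
        (\<exists>f' \<in> path_class X (const_path x). homotopically_close X f f')}"

definition open_cover :: "'a::topological_space set \<Rightarrow> 'a set set \<Rightarrow> bool" where
  "open_cover X \<U> \<longleftrightarrow> (\<forall>U\<in>\<U>. openin (top_of_set X) U) \<and> \<Union>\<U> = X"

text \<open>The trailing constant path does not affect homotopy classes; it serves the empty product.\<close>

definition path_product :: "'a::topological_space \<Rightarrow> (real \<Rightarrow> 'a) list \<Rightarrow> real \<Rightarrow> 'a" where
  "path_product x ps = foldr (+++) ps (const_path x)"

definition spanier_cover_group ::
    "'a::topological_space set \<Rightarrow> 'a set set \<Rightarrow> 'a \<Rightarrow> (real \<Rightarrow> 'a) set set" where
  "spanier_cover_group X \<U> x =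
     {path_class X (path_product x (map (\<lambda>(u, v). u +++ v +++ reversepath u) uvs)) | uvs.
        \<forall>(u, v) \<in> set uvs.
          u \<in> paths_from X x \<and> v \<in> loops_at X (pathfinish u) \<and> (\<exists>U\<in>\<U>. path_image v \<subseteq> U)}"

definition spanier_group ::
    "'a::topological_space set \<Rightarrow> 'a \<Rightarrow> (real \<Rightarrow> 'a) set set" where
  "spanier_group X x = (\<Inter>\<U>\<in>{\<U>. open_cover X \<U>}. spanier_cover_group X \<U> x)"


lemma path_class_eq_iff:
  assumes "path f" "path_image f \<subseteq> X"
  shows "path_class X f = path_class X g \<longleftrightarrow> homotopic_paths X f g"
proof
  assume "path_class X f = path_class X g"
  then have "f \<in> path_class X g"
    using assms by (auto simp: path_class_def)
  then show "homotopic_paths X f g"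
    by (simp add: path_class_def homotopic_paths_sym)
next
  assume "homotopic_paths X f g"
  then show "path_class X f = path_class X g"
    unfolding path_class_def
    by (intro Collect_cong iffI) (erule homotopic_paths_trans[OF homotopic_paths_sym],
      assumption, erule homotopic_paths_trans, assumption)
qed

lemma path_class_eqI: "homotopic_paths X f g \<Longrightarrow> path_class X f = path_class X g"
  using path_class_eq_iff[of f X g] homotopic_paths_imp_path[of X f g]
    homotopic_paths_imp_subset[of X f g] by simp

lemma loops_atD:
  assumes "f \<in> loops_at X x"
  shows "path f" "path_image f \<subseteq> X" "pathstart f = x" "pathfinish f = x"
  using assms by (auto simp: loops_at_def paths_from_def)

lemma loops_at_join: "f \<in> loops_at X x \<Longrightarrow> g \<in> loops_at X x \<Longrightarrow> f +++ g \<in> loops_at X x"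
  by (auto simp: loops_at_def paths_from_def path_image_join)

lemma loops_at_reversepath: "f \<in> loops_at X x \<Longrightarrow> reversepath f \<in> loops_at X x"
  by (auto simp: loops_at_def paths_from_def)

lemma loops_at_const: "x \<in> X \<Longrightarrow> const_path x \<in> loops_at X x"
  by (auto simp: loops_at_def paths_from_def path_def path_image_def pathstart_def pathfinish_def)

lemma fundamental_group_mult:
  assumes "f \<in> loops_at X x" "g \<in> loops_at X x"
  shows "path_class X f \<otimes>\<^bsub>fundamental_group X x\<^esub> path_class X g = path_class X (f +++ g)"
proof -
  have eq: "path_class X (f' +++ g') = path_class X (f +++ g)"
    if "f' \<in> path_class X f" "g' \<in> path_class X g" for f' g'
  proof -
    have "homotopic_paths X (f +++ g) (f' +++ g')"
      using that
      by (intro homotopic_paths_join)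
        (simp_all add: path_class_def loops_atD[OF assms(1)] loops_atD[OF assms(2)])
    then show ?thesis
      by (rule path_class_eqI[symmetric])
  qed
  have "f \<in> path_class X f" "g \<in> path_class X g"
    by (simp_all add: path_class_def loops_atD[OF assms(1)] loops_atD[OF assms(2)])
  then have "(\<Union>f'\<in>path_class X f. \<Union>g'\<in>path_class X g. path_class X (f' +++ g')) =
      path_class X (f +++ g)"
    using eq by blast
  then show ?thesis
    by (simp add: fundamental_group_def)
qed

text \<open>
  The library states the unit and inverse laws for paths in normed vector spaces only; they transfer
  along \<open>p\<close> from the identity path of \<open>{0..1}\<close>.
\<close>

lemma homotopic_paths_along:
  assumes "path p" "path_image p \<subseteq> X" "homotopic_paths {0..1} q r"
  shows "homotopic_paths X (p \<circ> q) (p \<circ> r)"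
  using assms
  by (intro homotopic_paths_continuous_image[of "{0..1}"]) (auto simp: path_def path_image_def)

lemma linepath_0_1: "linepath 0 (1::real) = (\<lambda>t. t)"
  by (auto simp: linepath_def)

lemma linepath_const: "linepath c (c::real) = (\<lambda>t. c)"
  by (auto simp: linepath_def algebra_simps)

lemma homotopic_paths_const_join:
  assumes "path p" "path_image p \<subseteq> X"
  shows "homotopic_paths X (const_path (pathstart p) +++ p) p"
proof -
  have "homotopic_paths {0..1} (linepath 0 0 +++ linepath 0 1) (linepath 0 (1::real))"
    by (rule homotopic_paths_lid') (auto simp: closed_segment_eq_real_ivl)
  from homotopic_paths_along[OF assms this] show ?thesis
    by (simp add: linepath_0_1 linepath_const joinpaths_def o_def pathstart_def if_distrib)
qed

lemma homotopic_paths_reversepath_join: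
  assumes "path p" "path_image p \<subseteq> X"
  shows "homotopic_paths X (reversepath p +++ p) (const_path (pathfinish p))"
proof -
  have "homotopic_paths {0..1} (reversepath (linepath 0 1) +++ linepath 0 1)
          (linepath (pathfinish (linepath 0 1)) (pathfinish (linepath 0 (1::real))))"
    by (rule homotopic_paths_linv) (auto simp: closed_segment_eq_real_ivl)
  from homotopic_paths_along[OF assms this] show ?thesis
    by (simp add: linepath_0_1 linepath_const joinpaths_def o_def pathfinish_def reversepath_def
        if_distrib)
qed

lemma group_fundamental_group:
  assumes "x \<in> X"
  shows "group (fundamental_group X x)"
proof (rule groupI)
  let ?G = "fundamental_group X x"
  have carrier: "carrier ?G = path_class X ` loops_at X x"
    and one: "\<one>\<^bsub>?G\<^esub> = path_class X (const_path x)"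
    by (auto simp: fundamental_group_def)
  note const = loops_at_const[OF assms]
  show "\<one>\<^bsub>?G\<^esub> \<in> carrier ?G"
    using const by (auto simp: carrier one)
  fix A assume "A \<in> carrier ?G"
  then obtain f where f: "f \<in> loops_at X x" "A = path_class X f"
    by (auto simp: carrier)
  show "\<one>\<^bsub>?G\<^esub> \<otimes>\<^bsub>?G\<^esub> A = A"
    using path_class_eqI[OF homotopic_paths_const_join[of f X]] f const
    by (simp add: one fundamental_group_mult loops_atD[OF f(1)])
  show "\<exists>B\<in>carrier ?G. B \<otimes>\<^bsub>?G\<^esub> A = \<one>\<^bsub>?G\<^esub>"
  proof
    show "path_class X (reversepath f) \<in> carrier ?G"
      using f by (auto simp: carrier intro: loops_at_reversepath)
    show "path_class X (reversepath f) \<otimes>\<^bsub>?G\<^esub> A = \<one>\<^bsub>?G\<^esub>"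
      using path_class_eqI[OF homotopic_paths_reversepath_join[of f X]] f
      by (simp add: one fundamental_group_mult loops_at_reversepath loops_atD[OF f(1)])
  qed
  fix B assume "B \<in> carrier ?G"
  then obtain g where g: "g \<in> loops_at X x" "B = path_class X g"
    by (auto simp: carrier)
  show "A \<otimes>\<^bsub>?G\<^esub> B \<in> carrier ?G"
    using f g by (auto simp: carrier fundamental_group_mult intro: loops_at_join)
  fix C assume "C \<in> carrier ?G"
  then obtain h where h: "h \<in> loops_at X x" "C = path_class X h"
    by (auto simp: carrier)
  have "homotopic_paths X (f +++ (g +++ h)) ((f +++ g) +++ h)"
    by (rule homotopic_paths_assoc)
      (simp_all add: loops_atD[OF f(1)] loops_atD[OF g(1)] loops_atD[OF h(1)])
  from path_class_eqI[OF this] show "A \<otimes>\<^bsub>?G\<^esub> B \<otimes>\<^bsub>?G\<^esub> C = A \<otimes>\<^bsub>?G\<^esub> (B \<otimes>\<^bsub>?G\<^esub> C)"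
    using f g h by (simp add: fundamental_group_mult loops_at_join)
qed

end

theory Submission
  imports Defs
begin

text \<open>
  Closeness of \<open>f\<close> to \<open>g\<close> says that every basic compact-open neighbourhood of \<open>g\<close>, taken among the
  paths that agree with \<open>g\<close> at finitely many prescribed times, contains a path homotopic to \<open>f\<close>. The
  definition describes such neighbourhoods by one partition of the unit interval, which behaves badly
  under concatenation: a partition of the concatenated interval need not contain the midpoint.
  Lemma \<open>homotopically_close_iff_constraints\<close> therefore replaces partitions by arbitrary finite
  families of subintervals. These can be clipped and rescaled freely, so closeness is seen to
  be compatible with concatenation, with reversal, and with homotopies of \<open>f\<close>.

  This compatibility makes the quasi-small classes a subgroup. It also yields the first
  inclusion: if \<open>\<alpha>\<close> is close to a constant path, then \<open>\<beta> +++ \<alpha> +++ reversepath \<beta>\<close> is close to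
  \<open>\<beta>\<close> followed by a constant path and by the reverse of \<open>\<beta>\<close>, and this path is null-homotopic. So all
  generators of the small generated subgroup are quasi-small.

  For the second inclusion, let \<open>f\<close> be close to a null-homotopic loop \<open>g\<close> and let an open cover be
  given. A Lebesgue number provides a partition such that \<open>g\<close> maps each subinterval into a member of
  the cover, and closeness provides \<open>\<gamma>\<close> homotopic to \<open>f\<close> that follows \<open>g\<close> through the same members and
  meets \<open>g\<close> at the partition points. Hence \<open>\<gamma>\<close> followed by the reverse of \<open>g\<close> is homotopic to a
  product of lassos: the lasso for a subinterval runs along \<open>g\<close> up to its left end, goes
  through the subinterval along \<open>\<gamma>\<close> and back along \<open>g\<close>, and returns. The telescoping of this product is
  \<open>difference_in_spanier_cover_group\<close>. As \<open>g\<close> is null-homotopic, the product is homotopic to \<open>f\<close>.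
\<close>

section \<open>Homotopies of paths\<close>

text \<open>
  The interval is convex, so the straight-line homotopy joins the two parametrizations, and \<open>p\<close>
  carries it into \<open>X\<close>. This is what makes unit laws and subdivision of paths available in an arbitrary
  topological space.
\<close>

lemma homotopic_paths_reparametrized:
  fixes q r :: "real \<Rightarrow> real"
  assumes "path p" "path_image p \<subseteq> X"
    and q: "path q" "path_image q \<subseteq> {0..1}" and r: "path r" "path_image r \<subseteq> {0..1}"
    and ends: "pathstart q = pathstart r" "pathfinish q = pathfinish r"
  shows "homotopic_paths X (p \<circ> q) (p \<circ> r)"
proof (rule homotopic_paths_along[OF assms(1,2)])
  show "homotopic_paths {0..1} q r"
  proof (rule homotopic_paths_linear)
    fix t :: real assume t: "t \<in> {0..1}"
    then have "q t \<in> {0..1}" "r t \<in> {0..1}"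
      using q(2) r(2) unfolding path_image_def by blast+
    then show "closed_segment (q t) (r t) \<subseteq> {0..1}"
      by (intro closed_segment_subset) auto
  qed (use q r ends in auto)
qed

lemma comp_joinpaths: "p \<circ> (q +++ r) = (p \<circ> q) +++ (p \<circ> r)"
  by (auto simp: joinpaths_def)

lemma homotopic_paths_join_const:
  assumes "path p" "path_image p \<subseteq> X"
  shows "homotopic_paths X (p +++ const_path (pathfinish p)) p"
proof -
  have "homotopic_paths X (p \<circ> (linepath 0 1 +++ linepath 1 1)) (p \<circ> linepath 0 1)"
    using assms by (rule homotopic_paths_reparametrized)
      (auto simp: path_image_join closed_segment_eq_real_ivl)
  then show ?thesis
    unfolding comp_joinpaths by (simp add: linepath_0_1 linepath_const o_def pathfinish_def)
qed

lemma homotopic_paths_join_reversepath: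
  assumes "path p" "path_image p \<subseteq> X"
  shows "homotopic_paths X (p +++ reversepath p) (const_path (pathstart p))"
  using homotopic_paths_reversepath_join[of "reversepath p" X] assms by simp

lemma homotopic_paths_cancel_left:
  assumes q: "path q" "path_image q \<subseteq> X" and r: "path r" "path_image r \<subseteq> X"
    and "pathfinish q = pathstart r"
  shows "homotopic_paths X (reversepath q +++ (q +++ r)) r"
proof -
  have "homotopic_paths X (reversepath q +++ (q +++ r)) ((reversepath q +++ q) +++ r)"
    by (rule homotopic_paths_assoc) (use assms in auto)
  also have "homotopic_paths X \<dots> (const_path (pathfinish q) +++ r)"
    by (rule homotopic_paths_join) (use assms homotopic_paths_reversepath_join[OF q] in auto)
  also have "homotopic_paths X \<dots> r"
    using homotopic_paths_const_join[OF r] assms by simp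
  finally show ?thesis .
qed

lemma homotopic_paths_conjugate_null:
  assumes "path p" "path_image p \<subseteq> X"
  shows "homotopic_paths X (p +++ const_path (pathfinish p) +++ reversepath p)
           (const_path (pathstart p))"
proof -
  have "homotopic_paths X (const_path (pathfinish p) +++ reversepath p) (reversepath p)"
    using homotopic_paths_const_join[of "reversepath p" X] assms by simp
  then have "homotopic_paths X (p +++ const_path (pathfinish p) +++ reversepath p)
      (p +++ reversepath p)"
    by (intro homotopic_paths_join) (use assms in \<open>auto simp: pathstart_def joinpaths_def\<close>)
  also have "homotopic_paths X \<dots> (const_path (pathstart p))"
    by (rule homotopic_paths_join_reversepath[OF assms])
  finally show ?thesis .
qed

section \<open>The fundamental group\<close>

lemma fundamental_group_carrier:
  "carrier (fundamental_group X x) = path_class X ` loops_at X x"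
  by (simp add: fundamental_group_def)

lemma fundamental_group_one: "\<one>\<^bsub>fundamental_group X x\<^esub> = path_class X (const_path x)"
  by (simp add: fundamental_group_def)

lemma fundamental_group_inv:
  assumes "f \<in> loops_at X x"
  shows "inv\<^bsub>fundamental_group X x\<^esub> path_class X f = path_class X (reversepath f)"
proof -
  note f = loops_atD[OF assms]
  have "x \<in> X"
    using f pathstart_in_path_image by blast
  then interpret group "fundamental_group X x"
    by (rule group_fundamental_group)
  show ?thesis
    using path_class_eqI[OF homotopic_paths_reversepath_join[OF f(1,2)]] assms f(4)
    by (intro inv_equality)
      (simp_all add: fundamental_group_carrier fundamental_group_one fundamental_group_mult
        loops_at_reversepath)
qed

lemma conjugate_in_loops_at:
  assumes "u \<in> paths_from X x" "v \<in> loops_at X (pathfinish u)"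
  shows "u +++ v +++ reversepath u \<in> loops_at X x"
  using assms by (auto simp: loops_at_def paths_from_def path_image_join)

section \<open>Homotopical closeness\<close>

lemma homotopically_closeE:
  fixes t :: "nat \<Rightarrow> real"
  assumes "homotopically_close X f g" "t 0 = 0" "t n = 1" "\<And>i. i < n \<Longrightarrow> t i < t (Suc i)"
    and "\<And>i. i < n \<Longrightarrow> openin (top_of_set X) (U i) \<and> g ` {t i..t (Suc i)} \<subseteq> U i"
  obtains \<gamma> where "path \<gamma>" "path_image \<gamma> \<subseteq> X" "\<forall>i<n. \<gamma> ` {t i..t (Suc i)} \<subseteq> U i"
    "\<forall>i\<le>n. \<gamma> (t i) = g (t i)" "homotopic_paths X \<gamma> f"
proof -
  have "\<exists>\<gamma>. path \<gamma> \<and> path_image \<gamma> \<subseteq> X \<and> (\<forall>i<n. \<gamma> ` {t i..t (Suc i)} \<subseteq> U i) \<and>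
      (\<forall>i\<le>n. \<gamma> (t i) = g (t i)) \<and> homotopic_paths X \<gamma> f"
    using assms(1) unfolding homotopically_close_def
    by (elim conjE allE[of _ n] allE[of _ t] allE[of _ U]) (simp add: assms(2-5))
  then show thesis
    using that by blast
qed

text \<open>
  A triple \<open>(a, b, V)\<close> demands that the interval from \<open>a\<close> to \<open>b\<close> be mapped into \<open>V\<close> and that \<open>a\<close> and
  \<open>b\<close> be mapped as \<open>g\<close> maps them. Intervals may overlap, leave gaps, or shrink to a point, so that
  families remain admissible after clipping.
\<close>

definition constraints ::
    "'a::topological_space set \<Rightarrow> (real \<Rightarrow> 'a) \<Rightarrow> (real \<times> real \<times> 'a set) set \<Rightarrow> bool" where
  "constraints X g C \<longleftrightarrow> finite C \<and>
     (\<forall>(a, b, V) \<in> C. 0 \<le> a \<and> a \<le> b \<and> b \<le> 1 \<and> openin (top_of_set X) V \<and> g ` {a..b} \<subseteq> V)"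

lemma constraintsD:
  assumes "constraints X g C" "(a, b, V) \<in> C"
  shows "0 \<le> a" "a \<le> b" "b \<le> 1" "openin (top_of_set X) V" "g ` {a..b} \<subseteq> V"
  using assms unfolding constraints_def by blast+

definition obeys ::
    "(real \<Rightarrow> 'a) \<Rightarrow> (real \<Rightarrow> 'a) \<Rightarrow> (real \<times> real \<times> 'a set) set \<Rightarrow> bool" where
  "obeys \<gamma> g C \<longleftrightarrow> (\<forall>(a, b, V) \<in> C. \<gamma> ` {a..b} \<subseteq> V \<and> \<gamma> a = g a \<and> \<gamma> b = g b)"

lemma finite_set_increasing_enumeration:
  fixes S :: "'b::linorder set"
  assumes "finite S" "l \<in> S" "u \<in> S" "\<forall>s\<in>S. l \<le> s \<and> s \<le> u"
  obtains n and t :: "nat \<Rightarrow> 'b"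
  where "t 0 = l" "t n = u" "\<And>i j. i < j \<Longrightarrow> j \<le> n \<Longrightarrow> t i < t j" "S = t ` {..n}"
proof -
  define xs where "xs = sorted_list_of_set S"
  define n where "n = length xs - 1"
  have set: "set xs = S" and sorted: "sorted_wrt (<) xs"
    using assms(1) by (auto simp: xs_def)
  have "xs \<noteq> []"
    using set assms(2) by auto
  then have len: "length xs = Suc n"
    by (simp add: n_def)
  have less: "xs ! i < xs ! j" if "i < j" "j \<le> n" for i j
    using sorted_wrt_nth_less[OF sorted] that len by auto
  have im: "S = (!) xs ` {..n}"
    using set len by (auto simp: set_conv_nth less_Suc_eq_le)
  obtain i j where ij: "i \<le> n" "xs ! i = l" "j \<le> n" "xs ! j = u"
    using assms(2,3) im by auto
  have ends: "xs ! 0 \<in> S" "xs ! n \<in> S"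
    using im by auto
  have "i = 0"
    using less[of 0 i] ij ends assms(4) by (metis gr0I leD)
  moreover have "j = n"
    using less[of j n] ij ends assms(4) by (metis le_neq_implies_less leD order_refl)
  ultimately show thesis
    using that[of "(!) xs" n] ij less im by auto
qed

lemma ex_consecutive_between:
  fixes t :: "nat \<Rightarrow> 'b::linorder"
  assumes "j < k" "t j \<le> s" "s \<le> t k"
  shows "\<exists>i. j \<le> i \<and> i < k \<and> t i \<le> s \<and> s \<le> t (Suc i)"
  using assms
proof (induction k)
  case (Suc k)
  show ?case
  proof (cases "s \<le> t k \<and> j < k")
    case True
    then show ?thesis
      using Suc by (metis less_SucI)
  next
    case False
    then show ?thesis
      using Suc.prems by (metis less_Suc_eq linear lessI less_imp_le order_refl)
  qed
qed simp

text \<open>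
  A partition is itself a finite family of constraints. Conversely, the endpoints occurring in a finite
  family partition the unit interval. Each constraint interval is then a union of cells, so it is enough
  to send a cell into the intersection of all the open sets whose interval contains the cell.
\<close>

lemma homotopically_close_iff_constraints:
  "homotopically_close X f g \<longleftrightarrow>
     path f \<and> path_image f \<subseteq> X \<and> path g \<and> path_image g \<subseteq> X \<and>
     pathstart f = pathstart g \<and> pathfinish f = pathfinish g \<and>
     (\<forall>C. constraints X g C \<longrightarrow> (\<exists>\<gamma>. obeys \<gamma> g C \<and> homotopic_paths X \<gamma> f))"
    (is "_ = ?rhs")
proof
  assume close: "homotopically_close X f g"
  have "\<exists>\<gamma>. obeys \<gamma> g C \<and> homotopic_paths X \<gamma> f" if C: "constraints X g C" for C
  proof -
    define S where "S = {0, 1} \<union> (\<Union>(a, b, V)\<in>C. {a, b})"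
    have S: "finite S" "0 \<in> S" "1 \<in> S" "\<forall>s\<in>S. 0 \<le> s \<and> s \<le> 1"
      using C by (auto simp: S_def constraints_def)
    obtain n and t :: "nat \<Rightarrow> real" where t0: "t 0 = 0" and tn: "t n = 1"
        and less: "\<And>i j. i < j \<Longrightarrow> j \<le> n \<Longrightarrow> t i < t j" and im: "S = t ` {..n}"
      by (rule finite_set_increasing_enumeration[OF S], rule that)
    have mono: "t i \<le> t j" if "i \<le> j" "j \<le> n" for i j
      using less[of i j] that by (cases "i = j") auto
    \<comment> \<open>Inserting \<open>X\<close> keeps the intersection open in \<open>X\<close> when no constraint covers the cell.\<close>
    define U where "U i = \<Inter>(insert X {V. \<exists>a b. (a, b, V) \<in> C \<and> a \<le> t i \<and> t (Suc i) \<le> b})" for i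
    have U: "openin (top_of_set X) (U i)" "g ` {t i..t (Suc i)} \<subseteq> U i" if "i < n" for i
    proof -
      have "{V. \<exists>a b. (a, b, V) \<in> C \<and> a \<le> t i \<and> t (Suc i) \<le> b} \<subseteq> (\<lambda>(a, b, V). V) ` C"
        by force
      then have "finite {V. \<exists>a b. (a, b, V) \<in> C \<and> a \<le> t i \<and> t (Suc i) \<le> b}"
        using C by (meson constraints_def finite_imageI finite_subset)
      then show "openin (top_of_set X) (U i)"
        using C unfolding U_def by (intro openin_Inter) (auto simp: constraints_def)
      have "t i \<in> S" "t (Suc i) \<in> S"
        using im that by auto
      then have "{t i..t (Suc i)} \<subseteq> {0..1}"
        using S by auto
      moreover have "path_image g \<subseteq> X"
        using close by (simp add: homotopically_close_def)
      ultimately have "g ` {t i..t (Suc i)} \<subseteq> X"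
        by (auto simp: path_image_def)
      moreover have "g ` {t i..t (Suc i)} \<subseteq> V"
        if "(a, b, V) \<in> C" "a \<le> t i" "t (Suc i) \<le> b" for a b V
      proof -
        have "g ` {t i..t (Suc i)} \<subseteq> g ` {a..b}"
          using that(2,3) by (intro image_mono) auto
        also have "\<dots> \<subseteq> V"
          by (rule constraintsD(5)[OF C that(1)])
        finally show ?thesis .
      qed
      ultimately show "g ` {t i..t (Suc i)} \<subseteq> U i"
        unfolding U_def by blast
    qed
    obtain \<gamma> where \<gamma>: "\<forall>i<n. \<gamma> ` {t i..t (Suc i)} \<subseteq> U i" "\<forall>i\<le>n. \<gamma> (t i) = g (t i)"
        "homotopic_paths X \<gamma> f"
      by (rule homotopically_closeE[OF close t0 tn, of U]) (use U less in auto)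
    have "\<gamma> ` {a..b} \<subseteq> V \<and> \<gamma> a = g a \<and> \<gamma> b = g b" if abV: "(a, b, V) \<in> C" for a b V
    proof -
      have "a \<in> S" "b \<in> S"
        using abV by (force simp: S_def)+
      then obtain j k where jk: "j \<le> n" "a = t j" "k \<le> n" "b = t k"
        using im by auto
      have "g ` {a..b} \<subseteq> V" "a \<le> b"
        by (rule constraintsD[OF C abV])+
      have "\<gamma> s \<in> V" if s: "a \<le> s" "s \<le> b" for s
      proof (cases "a = b")
        case True
        then show ?thesis
          using s jk \<gamma>(2) \<open>g ` {a..b} \<subseteq> V\<close> by auto
      next
        case False
        then have "j < k"
          using mono[of k j] jk \<open>a \<le> b\<close> by force
        then obtain i where i: "j \<le> i" "i < k" "t i \<le> s" "s \<le> t (Suc i)"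
          using ex_consecutive_between[of j k t s] jk s by auto
        then have "\<gamma> ` {t i..t (Suc i)} \<subseteq> U i"
          using \<gamma>(1) jk(3) by simp
        then have "\<gamma> s \<in> U i"
          using i(3,4) by (simp add: image_subset_iff)
        moreover have "a \<le> t i" "t (Suc i) \<le> b"
          using mono[of j i] mono[of "Suc i" k] i jk by auto
        ultimately show ?thesis
          using abV by (auto simp: U_def)
      qed
      then show ?thesis
        using jk \<gamma>(2) by auto
    qed
    then show ?thesis
      using \<gamma>(3) unfolding obeys_def by blast
  qed
  then show ?rhs
    using close by (simp add: homotopically_close_def)
next
  assume R: ?rhs
  have "\<exists>\<gamma>. path \<gamma> \<and> path_image \<gamma> \<subseteq> X \<and> (\<forall>i<n. \<gamma> ` {t i..t (Suc i)} \<subseteq> U i) \<and>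
             (\<forall>i\<le>n. \<gamma> (t i) = g (t i)) \<and> homotopic_paths X \<gamma> f"
    if t: "t 0 = 0" "t n = 1" "\<forall>i<n. t i < t (Suc i)"
      and U: "\<forall>i<n. openin (top_of_set X) (U i) \<and> g ` {t i..t (Suc i)} \<subseteq> U i"
    for n and t :: "nat \<Rightarrow> real" and U
  proof -
    have t01: "0 \<le> t i \<and> t i \<le> 1" if "i \<le> n" for i
    proof
      show "0 \<le> t i"
        using that
      proof (induction i)
        case (Suc i)
        then show ?case
          using t(3) by (metis Suc_le_eq less_imp_le order_trans)
      qed (simp add: t(1))
      show "t i \<le> 1"
        using that
      proof (induction rule: inc_induct)
        case (step i)
        then show ?case
          using t(3) by (metis less_imp_le order_trans)
      qed (simp add: t(2))
    qed
    define C where "C = (\<lambda>i. (t i, t (Suc i), U i)) ` {..<n}"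
    have "constraints X g C"
      using U t(3) t01 by (auto simp: constraints_def C_def less_imp_le)
    then obtain \<gamma> where \<gamma>: "obeys \<gamma> g C" "homotopic_paths X \<gamma> f"
      using R by blast
    have "\<gamma> (t i) = g (t i)" if "i \<le> n" for i
    proof (cases "i < n")
      case False
      \<comment> \<open>The last time is not a left end; there a homotopy keeps the endpoint that \<open>f\<close> shares with \<open>g\<close>.\<close>
      then have "i = n"
        using that by simp
      then show ?thesis
        using R homotopic_paths_imp_pathfinish[OF \<gamma>(2)] t(2) by (simp add: pathfinish_def)
    qed (use \<gamma>(1) in \<open>auto simp: obeys_def C_def\<close>)
    then show ?thesis
      using \<gamma> homotopic_paths_imp_path[OF \<gamma>(2)] homotopic_paths_imp_subset[OF \<gamma>(2)]
      by (intro exI[of _ \<gamma>]) (auto simp: obeys_def C_def)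
  qed
  then show "homotopically_close X f g"
    using R unfolding homotopically_close_def by blast
qed

lemma homotopically_close_refl:
  assumes "path f" "path_image f \<subseteq> X"
  shows "homotopically_close X f f"
proof -
  have "obeys f f C" if "constraints X f C" for C
    using that unfolding constraints_def obeys_def by fast
  then show ?thesis
    unfolding homotopically_close_iff_constraints using assms homotopic_paths_refl by blast
qed

lemma homotopically_close_homotopic:
  assumes "homotopically_close X f g" "homotopic_paths X f f'"
  shows "homotopically_close X f' g"
proof -
  have "path f'" "path_image f' \<subseteq> X" "pathstart f' = pathstart f" "pathfinish f' = pathfinish f"
    using assms(2) homotopic_paths_imp_path homotopic_paths_imp_subset
      homotopic_paths_imp_pathstart homotopic_paths_imp_pathfinish by metis+
  moreover have "\<exists>\<gamma>. obeys \<gamma> g C \<and> homotopic_paths X \<gamma> f'" if "constraints X g C" for C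
    using assms(1) that homotopic_paths_trans[OF _ assms(2)]
    unfolding homotopically_close_iff_constraints by blast
  ultimately show ?thesis
    using assms(1) by (simp add: homotopically_close_iff_constraints)
qed

lemma homotopically_close_reversepath:
  assumes close: "homotopically_close X f g"
  shows "homotopically_close X (reversepath f) (reversepath g)"
proof -
  have "\<exists>\<gamma>. obeys \<gamma> (reversepath g) C \<and> homotopic_paths X \<gamma> (reversepath f)"
    if C: "constraints X (reversepath g) C" for C
  proof -
    let ?D = "(\<lambda>(a, b, V). (1 - b, 1 - a, V)) ` C"
    have im: "p ` {1 - b..1 - a} = reversepath p ` {a..b}" for p :: "real \<Rightarrow> 'a" and a b
    proof -
      have "{1 - b..1 - a} = (\<lambda>s. 1 - s) ` {a..b}"
        by simp
      then show ?thesis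
        unfolding reversepath_def by (simp only: image_image)
    qed
    have "constraints X g ?D"
      using C by (auto simp: constraints_def im split: prod.splits) 
    then obtain \<gamma> where \<gamma>: "obeys \<gamma> g ?D" "homotopic_paths X \<gamma> f"
      using close unfolding homotopically_close_iff_constraints by blast
    have "obeys (reversepath \<gamma>) (reversepath g) C"
      unfolding obeys_def
    proof (clarify, intro conjI)
      fix a b V assume "(a, b, V) \<in> C"
      then have "(1 - b, 1 - a, V) \<in> ?D"
        by force
      then have *: "\<gamma> ` {1 - b..1 - a} \<subseteq> V \<and> \<gamma> (1 - b) = g (1 - b) \<and> \<gamma> (1 - a) = g (1 - a)"
        using \<gamma>(1) unfolding obeys_def by blast
      then show "reversepath \<gamma> ` {a..b} \<subseteq> V"
        by (simp only: im)
      show "reversepath \<gamma> a = reversepath g a" "reversepath \<gamma> b = reversepath g b"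
        using * by (auto simp: reversepath_def)
    qed
    then show ?thesis
      using \<gamma>(2) homotopic_paths_reversepath_D by blast
  qed
  then show ?thesis
    using close by (simp add: homotopically_close_iff_constraints)
qed

text \<open>
  Cut every constraint at the midpoint and rescale the two halves to the unit interval. Paths that obey
  the resulting constraints for \<open>g1\<close> and for \<open>g2\<close> concatenate to a path that obeys the original ones.
\<close>

lemma homotopically_close_join:
  assumes close1: "homotopically_close X f1 g1" and close2: "homotopically_close X f2 g2"
    and ends: "pathfinish f1 = pathstart f2"
  shows "homotopically_close X (f1 +++ f2) (g1 +++ g2)"
proof -
  note c1 = close1[unfolded homotopically_close_iff_constraints]
  note c2 = close2[unfolded homotopically_close_iff_constraints]
  have g: "pathfinish g1 = pathstart g2"
    using c1 c2 ends by simp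
  have first: "(p +++ q) s = p (2 * s)" if "s \<le> 1/2" for p q :: "real \<Rightarrow> 'a" and s
    using that by (simp add: joinpaths_def)
  have second: "(p +++ q) s = q (2 * s - 1)" if "1/2 \<le> s" "pathfinish p = pathstart q"
    for p q :: "real \<Rightarrow> 'a" and s
  proof (cases "s = 1/2")
    case True
    show ?thesis
      unfolding True using that(2) by (simp add: joinpaths_def pathfinish_def pathstart_def)
  qed (use that in \<open>simp add: joinpaths_def\<close>)
  have "\<exists>\<gamma>. obeys \<gamma> (g1 +++ g2) C \<and> homotopic_paths X \<gamma> (f1 +++ f2)"
    if C: "constraints X (g1 +++ g2) C" for C
  proof -
    define C1 where "C1 = (\<lambda>(a, b, V). (2 * a, min 1 (2 * b), V)) ` {(a, b, V) \<in> C. a \<le> 1/2}"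
    define C2 where "C2 = (\<lambda>(a, b, V). (max 0 (2 * a - 1), 2 * b - 1, V)) ` {(a, b, V) \<in> C. 1/2 \<le> b}"
    have "finite C"
      using C by (simp add: constraints_def)
    then have fin: "finite C1" "finite C2"
      unfolding C1_def C2_def by (intro finite_imageI; rule rev_finite_subset; blast)+
    have CD: "0 \<le> a" "a \<le> b" "b \<le> 1" "openin (top_of_set X) V" "\<And>s. a \<le> s \<Longrightarrow> s \<le> b \<Longrightarrow> (g1 +++ g2) s \<in> V"
      if "(a, b, V) \<in> C" for a b V
      using constraintsD[OF C that] by auto
    have g1: "g1 ` {2 * a..min 1 (2 * b)} \<subseteq> V" if "(a, b, V) \<in> C" for a b V
    proof clarify
      fix s assume "s \<in> {2 * a..min 1 (2 * b)}"
      then show "g1 s \<in> V"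
        using CD(5)[OF that, of "s / 2"] first[of "s / 2" g1 g2] by auto
    qed
    have con1: "constraints X g1 C1"
      unfolding constraints_def
    proof (intro conjI fin ballI)
      fix c assume "c \<in> C1"
      then obtain a b V where abV: "(a, b, V) \<in> C" "a \<le> 1/2" "c = (2 * a, min 1 (2 * b), V)"
        by (auto simp: C1_def)
      show "case c of (a, b, V) \<Rightarrow>
          0 \<le> a \<and> a \<le> b \<and> b \<le> 1 \<and> openin (top_of_set X) V \<and> g1 ` {a..b} \<subseteq> V"
        unfolding abV(3) prod.case using g1[OF abV(1)] CD(1,2,4)[OF abV(1)] abV(2)
        by (intro conjI) simp_all
    qed
    have g2: "g2 ` {max 0 (2 * a - 1)..2 * b - 1} \<subseteq> V" if "(a, b, V) \<in> C" for a b V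
    proof clarify
      fix s assume "s \<in> {max 0 (2 * a - 1)..2 * b - 1}"
      then show "g2 s \<in> V"
        using CD(5)[OF that, of "(s + 1) / 2"] second[of "(s + 1) / 2" g1 g2] g
        by (auto simp: add_divide_distrib)
    qed
    have con2: "constraints X g2 C2"
      unfolding constraints_def
    proof (intro conjI fin ballI)
      fix c assume "c \<in> C2"
      then obtain a b V where abV: "(a, b, V) \<in> C" "1/2 \<le> b" "c = (max 0 (2 * a - 1), 2 * b - 1, V)"
        by (auto simp: C2_def)
      show "case c of (a, b, V) \<Rightarrow>
          0 \<le> a \<and> a \<le> b \<and> b \<le> 1 \<and> openin (top_of_set X) V \<and> g2 ` {a..b} \<subseteq> V"
        unfolding abV(3) prod.case using g2[OF abV(1)] CD(2,3,4)[OF abV(1)] abV(2)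
        by (intro conjI) simp_all
    qed
    obtain \<gamma>1 where \<gamma>1: "obeys \<gamma>1 g1 C1" "homotopic_paths X \<gamma>1 f1"
      using c1 con1 by blast
    obtain \<gamma>2 where \<gamma>2: "obeys \<gamma>2 g2 C2" "homotopic_paths X \<gamma>2 f2"
      using c2 con2 by blast
    have \<gamma>: "pathfinish \<gamma>1 = pathstart \<gamma>2"
      using homotopic_paths_imp_pathfinish[OF \<gamma>1(2)] homotopic_paths_imp_pathstart[OF \<gamma>2(2)] ends
      by simp
    have O1: "\<gamma>1 ` {2 * a..min 1 (2 * b)} \<subseteq> V" "\<gamma>1 (2 * a) = g1 (2 * a)"
        "\<gamma>1 (min 1 (2 * b)) = g1 (min 1 (2 * b))" if "(a, b, V) \<in> C" "a \<le> 1/2" for a b V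
    proof -
      have "(2 * a, min 1 (2 * b), V) \<in> C1"
        using that by (force simp: C1_def)
      then show "\<gamma>1 ` {2 * a..min 1 (2 * b)} \<subseteq> V" "\<gamma>1 (2 * a) = g1 (2 * a)"
        "\<gamma>1 (min 1 (2 * b)) = g1 (min 1 (2 * b))"
        using \<gamma>1(1) unfolding obeys_def by blast+
    qed
    have O2: "\<gamma>2 ` {max 0 (2 * a - 1)..2 * b - 1} \<subseteq> V" "\<gamma>2 (2 * b - 1) = g2 (2 * b - 1)"
        "\<gamma>2 (max 0 (2 * a - 1)) = g2 (max 0 (2 * a - 1))" if "(a, b, V) \<in> C" "1/2 \<le> b" for a b V
    proof -
      have "(max 0 (2 * a - 1), 2 * b - 1, V) \<in> C2"
        using that by (force simp: C2_def)
      then show "\<gamma>2 ` {max 0 (2 * a - 1)..2 * b - 1} \<subseteq> V" "\<gamma>2 (2 * b - 1) = g2 (2 * b - 1)"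
        "\<gamma>2 (max 0 (2 * a - 1)) = g2 (max 0 (2 * a - 1))"
        using \<gamma>2(1) unfolding obeys_def by blast+
    qed
    have "obeys (\<gamma>1 +++ \<gamma>2) (g1 +++ g2) C"
      unfolding obeys_def
    proof (clarify, intro conjI)
      fix a b V assume abV: "(a, b, V) \<in> C"
      show "(\<gamma>1 +++ \<gamma>2) ` {a..b} \<subseteq> V"
      proof clarify
        fix s assume s: "s \<in> {a..b}"
        show "(\<gamma>1 +++ \<gamma>2) s \<in> V"
        proof (cases "s \<le> 1/2")
          case True
          then show ?thesis
            using O1(1)[OF abV] s by (auto simp: first image_subset_iff)
        next
          case False
          then show ?thesis
            using O2(1)[OF abV] s \<gamma> by (auto simp: second image_subset_iff)
        qed
      qed
      show "(\<gamma>1 +++ \<gamma>2) a = (g1 +++ g2) a"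
      proof (cases "a \<le> 1/2")
        case True
        then show ?thesis
          using O1(2)[OF abV] by (simp add: first)
      next
        case False
        then show ?thesis
          using O2(3)[OF abV] CD(2)[OF abV] \<gamma> g by (simp add: second)
      qed
      show "(\<gamma>1 +++ \<gamma>2) b = (g1 +++ g2) b"
      proof (cases "b \<le> 1/2")
        case True
        then show ?thesis
          using O1(3)[OF abV] CD(2)[OF abV] by (simp add: first)
      next
        case False
        then show ?thesis
          using O2(2)[OF abV] \<gamma> g by (simp add: second)
      qed
    qed
    moreover have "homotopic_paths X (\<gamma>1 +++ \<gamma>2) (f1 +++ f2)"
      using \<gamma>1 \<gamma>2 \<gamma> by (intro homotopic_paths_join)
    ultimately show ?thesis
      by blast
  qed
  then show ?thesis
    using c1 c2 g ends by (simp add: homotopically_close_iff_constraints path_image_join)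
qed

section \<open>Quasi-small loops\<close>

lemma quasi_small_loop_groupI:
  assumes "f \<in> loops_at X x" "homotopically_close X f f'" "homotopic_paths X f' (const_path x)"
  shows "path_class X f \<in> quasi_small_loop_group X x"
  using assms homotopic_paths_sym unfolding quasi_small_loop_group_def path_class_def by blast

lemma subgroup_quasi_small_loop_group:
  assumes "x \<in> X"
  shows "subgroup (quasi_small_loop_group X x) (fundamental_group X x)"
proof -
  let ?Q = "quasi_small_loop_group X x"
  interpret group "fundamental_group X x"
    using assms by (rule group_fundamental_group)
  have QE: "\<exists>f f'. A = path_class X f \<and> f \<in> loops_at X x \<and> homotopically_close X f f' \<and>
      homotopic_paths X f' (const_path x)" if "A \<in> ?Q" for A
    using that homotopic_paths_sym unfolding quasi_small_loop_group_def path_class_def by blast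
  note const = loops_at_const[OF assms]
  show ?thesis
  proof (rule subgroupI)
    show "?Q \<subseteq> carrier (fundamental_group X x)"
      by (auto simp: fundamental_group_carrier quasi_small_loop_group_def)
    have "path_class X (const_path x) \<in> ?Q"
      using const loops_atD[OF const]
      by (intro quasi_small_loop_groupI[of _ _ _ "const_path x"] homotopically_close_refl) auto
    then show "?Q \<noteq> {}"
      by blast
    fix A assume "A \<in> ?Q"
    then obtain f f' where f: "A = path_class X f" "f \<in> loops_at X x" "homotopically_close X f f'"
        "homotopic_paths X f' (const_path x)"
      using QE by blast
    have "homotopic_paths X (reversepath f') (const_path x)"
      using homotopic_paths_reversepath_D[OF f(4)] by (simp add: reversepath_def)
    then show "inv\<^bsub>fundamental_group X x\<^esub> A \<in> ?Q"
      using f by (auto simp: fundamental_group_inv loops_at_reversepath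
          intro: quasi_small_loop_groupI homotopically_close_reversepath)
    fix B assume "B \<in> ?Q"
    then obtain g g' where g: "B = path_class X g" "g \<in> loops_at X x" "homotopically_close X g g'"
        "homotopic_paths X g' (const_path x)"
      using QE by blast
    have "pathfinish f' = pathstart g'"
      using homotopic_paths_imp_pathfinish[OF f(4)] homotopic_paths_imp_pathstart[OF g(4)]
      by (simp add: pathfinish_def pathstart_def)
    then have "homotopic_paths X (f' +++ g') (const_path x +++ const_path x)"
      by (intro homotopic_paths_join f g)
    then have "homotopic_paths X (f' +++ g') (const_path x)"
      by (simp add: joinpaths_def)
    moreover have "homotopically_close X (f +++ g) (f' +++ g')"
      using f g loops_atD by (metis homotopically_close_join)
    ultimately show "A \<otimes>\<^bsub>fundamental_group X x\<^esub> B \<in> ?Q"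
      using f g by (auto simp: fundamental_group_mult loops_at_join intro: quasi_small_loop_groupI)
  qed
qed

text \<open>
  The conjugate of \<open>\<alpha>\<close> by \<open>\<beta>\<close> inherits closeness from its three factors, to the conjugate of a constant
  path, which contracts along \<open>\<beta>\<close>.
\<close>

lemma small_loop_conjugate_quasi_small:
  assumes \<beta>: "\<beta> \<in> paths_from X x" and \<alpha>: "\<alpha> \<in> loops_at X (pathfinish \<beta>)"
    and small: "path_class X \<alpha> \<in> small_loop_group X (pathfinish \<beta>)"
  shows "path_class X (\<beta> +++ \<alpha> +++ reversepath \<beta>) \<in> quasi_small_loop_group X x"
proof -
  let ?c = "const_path (pathfinish \<beta>)"
  have b: "path \<beta>" "path_image \<beta> \<subseteq> X" "pathstart \<beta> = x"
    using \<beta> by (auto simp: paths_from_def)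
  obtain f where "path_class X \<alpha> = path_class X f" "homotopically_close X f ?c"
    using small unfolding small_loop_group_def by blast
  then have "homotopically_close X \<alpha> ?c"
    using loops_atD[OF \<alpha>] by (metis homotopically_close_homotopic homotopic_paths_sym path_class_eq_iff)
  then have "homotopically_close X (\<beta> +++ \<alpha> +++ reversepath \<beta>) (\<beta> +++ ?c +++ reversepath \<beta>)"
    using b loops_atD[OF \<alpha>]
    by (intro homotopically_close_join homotopically_close_refl) auto
  then show ?thesis
    using conjugate_in_loops_at[OF \<beta> \<alpha>] homotopic_paths_conjugate_null[OF b(1,2)] b(3)
    by (blast intro: quasi_small_loop_groupI)
qed

section \<open>Spanier groups\<close>

definition lassos :: "'a::topological_space set \<Rightarrow> 'a set set \<Rightarrow> 'a \<Rightarrow> (real \<Rightarrow> 'a) set" where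
  "lassos X \<U> x = {u +++ v +++ reversepath u | u v.
     u \<in> paths_from X x \<and> v \<in> loops_at X (pathfinish u) \<and> (\<exists>U\<in>\<U>. path_image v \<subseteq> U)}"

lemma lassos_subset_loops_at: "lassos X \<U> x \<subseteq> loops_at X x"
  by (auto simp: lassos_def intro: conjugate_in_loops_at)

text \<open>
  Reversing only the loop at the end of a lasso gives its inverse up to homotopy. This closes the set of
  lasso classes under inverses, so that products of lassos suffice to form the generated subgroup.
\<close>

lemma reversepath_lasso:
  assumes "l \<in> lassos X \<U> x"
  shows "\<exists>l'\<in>lassos X \<U> x. homotopic_paths X (reversepath l) l'"
proof -
  obtain u v where uv: "l = u +++ v +++ reversepath u" "u \<in> paths_from X x"
      "v \<in> loops_at X (pathfinish u)" "\<exists>U\<in>\<U>. path_image v \<subseteq> U"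
    using assms by (auto simp: lassos_def)
  let ?l' = "u +++ reversepath v +++ reversepath u"
  note v = loops_atD[OF uv(3)]
  have u: "path u" "path_image u \<subseteq> X"
    using uv(2) by (auto simp: paths_from_def)
  have "?l' \<in> lassos X \<U> x"
    unfolding lassos_def mem_Collect_eq
    by (rule exI[of _ u], rule exI[of _ "reversepath v"])
      (use uv in \<open>auto intro: loops_at_reversepath\<close>)
  moreover have "reversepath l = (u +++ reversepath v) +++ reversepath u"
    using u v by (simp add: uv(1) reversepath_joinpaths)
  then have "homotopic_paths X (reversepath l) ?l'"
    using homotopic_paths_sym[OF homotopic_paths_assoc[of u X "reversepath v" "reversepath u"]] u v
    by simp
  ultimately show ?thesis
    by blast
qed

lemma path_product_in_loops_at:
  assumes "x \<in> X" "set ps \<subseteq> loops_at X x"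
  shows "path_product x ps \<in> loops_at X x"
  using assms(2)
  by (induction ps) (auto simp: path_product_def loops_at_const[OF assms(1)] loops_at_join)

lemma spanier_cover_group_eq_lasso_products:
  "spanier_cover_group X \<U> x = {path_class X (path_product x ps) | ps. set ps \<subseteq> lassos X \<U> x}"
    (is "?S = ?P")
proof
  show "?S \<subseteq> ?P"
  proof
    fix A assume "A \<in> ?S"
    then obtain uvs where uvs: "A = path_class X (path_product x (map (\<lambda>(u, v). u +++ v +++ reversepath u) uvs))"
        "\<forall>(u, v) \<in> set uvs.
          u \<in> paths_from X x \<and> v \<in> loops_at X (pathfinish u) \<and> (\<exists>U\<in>\<U>. path_image v \<subseteq> U)"
      unfolding spanier_cover_group_def by blast
    have "set (map (\<lambda>(u, v). u +++ v +++ reversepath u) uvs) \<subseteq> lassos X \<U> x"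
      using uvs(2) by (force simp: lassos_def)
    then show "A \<in> ?P"
      using uvs(1) by blast
  qed
  have ex: "\<exists>uvs. ps = map (\<lambda>(u, v). u +++ v +++ reversepath u) uvs \<and> (\<forall>(u, v) \<in> set uvs.
          u \<in> paths_from X x \<and> v \<in> loops_at X (pathfinish u) \<and> (\<exists>U\<in>\<U>. path_image v \<subseteq> U))"
    if "set ps \<subseteq> lassos X \<U> x" for ps
    using that
  proof (induction ps)
    case (Cons p ps)
    then obtain uvs where "ps = map (\<lambda>(u, v). u +++ v +++ reversepath u) uvs" "\<forall>(u, v) \<in> set uvs.
          u \<in> paths_from X x \<and> v \<in> loops_at X (pathfinish u) \<and> (\<exists>U\<in>\<U>. path_image v \<subseteq> U)"
      by auto
    moreover obtain u v where "p = u +++ v +++ reversepath u" "u \<in> paths_from X x"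
        "v \<in> loops_at X (pathfinish u)" "\<exists>U\<in>\<U>. path_image v \<subseteq> U"
      using Cons.prems by (auto simp: lassos_def)
    ultimately show ?case
      by (intro exI[of _ "(u, v) # uvs"]) auto
  qed simp
  show "?P \<subseteq> ?S"
    unfolding spanier_cover_group_def using ex by blast
qed

text \<open>
  Products of lassos are closed under inverses because the inverse of a lasso is again a lasso up to
  homotopy. The subgroup laws thus come from those of generated subgroups.
\<close>

lemma spanier_cover_group_eq_generate:
  assumes "x \<in> X"
  shows "spanier_cover_group X \<U> x = generate (fundamental_group X x) (path_class X ` lassos X \<U> x)"
    (is "?S = generate ?G ?L")
proof -
  interpret group ?G
    using assms by (rule group_fundamental_group)
  note loops = lassos_subset_loops_at[of X \<U> x]
  have prod_Cons: "path_class X (path_product x (p # ps)) =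
      path_class X p \<otimes>\<^bsub>?G\<^esub> path_class X (path_product x ps)"
    if "set (p # ps) \<subseteq> lassos X \<U> x" for p ps
  proof -
    have "path_product x (p # ps) = p +++ path_product x ps"
      by (simp add: path_product_def)
    moreover have "p \<in> loops_at X x" "path_product x ps \<in> loops_at X x"
      using that loops assms by (auto intro!: path_product_in_loops_at)
    ultimately show ?thesis
      by (simp add: fundamental_group_mult)
  qed
  have in_carrier: "path_class X (path_product x ps) \<in> carrier ?G" if "set ps \<subseteq> lassos X \<U> x" for ps
    using that loops path_product_in_loops_at[OF assms] by (auto simp: fundamental_group_carrier)
  have prod_Nil: "path_class X (path_product x []) = \<one>\<^bsub>?G\<^esub>"
    by (simp add: path_product_def fundamental_group_one)
  have prod_append: "path_class X (path_product x (ps @ qs)) =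
      path_class X (path_product x ps) \<otimes>\<^bsub>?G\<^esub> path_class X (path_product x qs)"
    if "set ps \<subseteq> lassos X \<U> x" "set qs \<subseteq> lassos X \<U> x" for ps qs
    using that(1)
  proof (induction ps)
    case Nil
    then show ?case
      using in_carrier[OF that(2)] by (simp only: prod_Nil append_Nil l_one)
  next
    case (Cons p ps)
    have "path_class X p \<in> carrier ?G"
      using Cons.prems loops by (auto simp: fundamental_group_carrier)
    then show ?case
      using Cons that in_carrier prod_Cons[of p ps] prod_Cons[of p "ps @ qs"]
      by (simp add: m_assoc)
  qed
  have single: "\<exists>ps. path_class X l = path_class X (path_product x ps) \<and> set ps \<subseteq> lassos X \<U> x"
    if "l \<in> lassos X \<U> x" for l
  proof -
    have "path_class X (path_product x [l]) = path_class X l \<otimes>\<^bsub>?G\<^esub> \<one>\<^bsub>?G\<^esub>"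
      using prod_Cons[of l "[]"] that by (simp add: prod_Nil)
    moreover have "path_class X l \<in> carrier ?G"
      using that loops by (auto simp: fundamental_group_carrier)
    ultimately show ?thesis
      using that by (intro exI[of _ "[l]"]) auto
  qed
  have "A \<in> ?S" if "A \<in> generate ?G ?L" for A
    using that unfolding spanier_cover_group_eq_lasso_products mem_Collect_eq
  proof (induction rule: generate.induct)
    case one
    then show ?case
      using prod_Nil by (intro exI[of _ "[]"]) simp
  next
    case (incl h)
    then show ?case
      using single by auto
  next
    case (inv h)
    then obtain l where l: "h = path_class X l" "l \<in> lassos X \<U> x"
      by auto
    then obtain l' where "l' \<in> lassos X \<U> x" "path_class X (reversepath l) = path_class X l'"
      using reversepath_lasso path_class_eqI by metis
    moreover have "inv\<^bsub>?G\<^esub> h = path_class X (reversepath l)"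
      using l loops by (auto simp: fundamental_group_inv)
    ultimately show ?case
      using single[of l'] by metis
  next
    case (eng h1 h2)
    then obtain ps qs where "h1 = path_class X (path_product x ps)" "set ps \<subseteq> lassos X \<U> x"
      "h2 = path_class X (path_product x qs)" "set qs \<subseteq> lassos X \<U> x"
      by blast
    then show ?case
      by (intro exI[of _ "ps @ qs"]) (simp add: prod_append)
  qed
  moreover have "path_class X (path_product x ps) \<in> generate ?G ?L" if "set ps \<subseteq> lassos X \<U> x" for ps
    using that
  proof (induction ps)
    case Nil
    show ?case
      unfolding prod_Nil by (rule generate.one)
  next
    case (Cons p ps)
    then have "path_class X p \<in> ?L" "path_class X (path_product x ps) \<in> generate ?G ?L"
      by auto
    then show ?case
      unfolding prod_Cons[OF Cons.prems] by (rule generate.eng[OF generate.incl])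
  qed
  ultimately show ?thesis
    unfolding spanier_cover_group_eq_lasso_products by blast
qed

lemma subgroup_spanier_cover_group:
  assumes "x \<in> X"
  shows "subgroup (spanier_cover_group X \<U> x) (fundamental_group X x)"
proof -
  interpret group "fundamental_group X x"
    using assms by (rule group_fundamental_group)
  show ?thesis
    unfolding spanier_cover_group_eq_generate[OF assms]
    using lassos_subset_loops_at[of X \<U> x]
    by (intro generate_is_subgroup) (auto simp: fundamental_group_carrier)
qed

lemma subgroup_spanier_group:
  assumes "x \<in> X"
  shows "subgroup (spanier_group X x) (fundamental_group X x)"
proof -
  interpret group "fundamental_group X x"
    using assms by (rule group_fundamental_group)
  have "open_cover X {X}"
    by (simp add: open_cover_def)
  then show ?thesis
    unfolding spanier_group_def
    using assms by (intro subgroups_Inter) (auto intro: subgroup_spanier_cover_group)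
qed

section \<open>Quasi-small loops are products of lassos\<close>

text \<open>
  A Lebesgue number for the preimages of the cover bounds the mesh of a sufficient uniform partition.
\<close>

lemma path_subdivision_open_cover:
  assumes g: "path g" "path_image g \<subseteq> X" and \<U>: "open_cover X \<U>"
  obtains n where "0 < n"
    "\<And>i. i < n \<Longrightarrow> \<exists>U\<in>\<U>. g ` {real i / real n..real (Suc i) / real n} \<subseteq> U"
proof -
  have "\<exists>W. open W \<and> {0..1} \<inter> g -` U = {0..1} \<inter> W" if "U \<in> \<U>" for U
  proof -
    have "openin (top_of_set {0..1}) ({0..1} \<inter> g -` U)"
    proof (rule continuous_openin_preimage)
      show "continuous_on {0..1} g" "g \<in> {0..1} \<rightarrow> X"
        using g by (auto simp: path_def path_image_def)
      show "openin (top_of_set X) U"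
        using \<U> that by (simp add: open_cover_def)
    qed
    then show ?thesis
      by (simp add: openin_open)
  qed
  then obtain W where W: "\<And>U. U \<in> \<U> \<Longrightarrow> open (W U) \<and> {0..1} \<inter> g -` U = {0..1} \<inter> W U"
    by metis
  have covered: "{0..1} \<subseteq> \<Union>(W ` \<U>)"
  proof
    fix s :: real assume s: "s \<in> {0..1}"
    then have "g s \<in> \<Union>\<U>"
      using g \<U> by (auto simp: path_image_def open_cover_def)
    then show "s \<in> \<Union>(W ` \<U>)"
      using s W by blast
  qed
  then have "W ` \<U> \<noteq> {}"
    by force
  then obtain \<delta> where \<delta>: "0 < \<delta>" "\<And>T. \<lbrakk>T \<subseteq> {0..1}; diameter T < \<delta>\<rbrakk> \<Longrightarrow> \<exists>B \<in> W ` \<U>. T \<subseteq> B"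
    using Lebesgue_number_lemma[of "{0..1}" "W ` \<U>"] covered W by (metis compact_Icc imageE)
  obtain n where n: "0 < n" "inverse (real n) < \<delta>"
    using \<delta>(1) by (metis reals_Archimedean zero_less_Suc)
  have "\<exists>U\<in>\<U>. g ` {real i / real n..real (Suc i) / real n} \<subseteq> U" if "i < n" for i
  proof -
    let ?J = "{real i / real n..real (Suc i) / real n}"
    have J: "?J \<subseteq> {0..1}"
      using that n(1) by (auto simp: field_simps)
    have "real (Suc i) / real n - real i / real n = inverse (real n)"
      using n(1) by (simp add: field_simps)
    moreover have "real i / real n \<le> real (Suc i) / real n"
      by (simp add: divide_right_mono)
    ultimately have "diameter ?J < \<delta>"
      using n by (simp add: diameter_closed_interval)
    then obtain U where "U \<in> \<U>" "?J \<subseteq> W U"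
      using \<delta>(2) J by blast
    then have "g ` ?J \<subseteq> U"
      using W[of U] J by blast
    then show ?thesis
      using \<open>U \<in> \<U>\<close> by blast
  qed
  then show thesis
    using that n(1) by blast
qed

lemma homotopic_paths_join_segments:
  assumes "path p" "path_image p \<subseteq> X" "{u, v, w} \<subseteq> {0..1}"
  shows "homotopic_paths X (p \<circ> linepath u w) ((p \<circ> linepath u v) +++ (p \<circ> linepath v w))"
  unfolding comp_joinpaths[symmetric]
  using assms(1,2) by (rule homotopic_paths_reparametrized)
    (use assms(3) in \<open>auto simp: path_image_join closed_segment_eq_real_ivl split: if_splits\<close>)

lemma path_segment:
  assumes "path p" "path_image p \<subseteq> X" "u \<in> {0..1}" "v \<in> {0..1}"
  shows "path (p \<circ> linepath u v)" "path_image (p \<circ> linepath u v) \<subseteq> X"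
    "pathstart (p \<circ> linepath u v) = p u" "pathfinish (p \<circ> linepath u v) = p v"
proof -
  have "homotopic_paths X (p \<circ> linepath u v) (p \<circ> linepath u v)"
    using assms(1,2) by (rule homotopic_paths_reparametrized)
      (use assms(3,4) in \<open>auto simp: closed_segment_eq_real_ivl split: if_splits\<close>)
  then show "path (p \<circ> linepath u v)" "path_image (p \<circ> linepath u v) \<subseteq> X"
    by auto
  show "pathstart (p \<circ> linepath u v) = p u" "pathfinish (p \<circ> linepath u v) = p v"
    by (auto simp: pathstart_compose pathfinish_compose)
qed

text \<open>
  The telescoping step. Here \<open>p\<close>, \<open>q\<close> are the initial parts of two paths and \<open>d\<close>, \<open>e\<close> their next segments.
  Extending both paths multiplies the difference loop by the conjugate by \<open>q\<close> of the difference of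
  the segments, because the inner copies of \<open>q\<close> cancel.
\<close>

lemma homotopic_paths_join_difference:
  assumes p: "path p" "path_image p \<subseteq> X" and q: "path q" "path_image q \<subseteq> X"
    and d: "path d" "path_image d \<subseteq> X" and e: "path e" "path_image e \<subseteq> X"
    and ends: "pathstart p = pathstart q" "pathfinish p = pathfinish q"
      "pathstart d = pathfinish p" "pathstart e = pathfinish q" "pathfinish d = pathfinish e"
  shows "homotopic_paths X ((p +++ d) +++ reversepath (q +++ e))
    ((p +++ reversepath q) +++ (q +++ (d +++ reversepath e) +++ reversepath q))"
proof -
  let ?z = "(d +++ reversepath e) +++ reversepath q"
  note facts = p q d e ends
  have z: "homotopic_paths X ?z (d +++ (reversepath e +++ reversepath q))"
    by (rule homotopic_paths_sym[OF homotopic_paths_assoc]) (use facts in auto)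
  have "homotopic_paths X ((p +++ reversepath q) +++ (q +++ ?z)) (p +++ (reversepath q +++ (q +++ ?z)))"
    by (rule homotopic_paths_sym[OF homotopic_paths_assoc])
      (use facts in \<open>auto simp: path_image_join\<close>)
  also have "homotopic_paths X \<dots> (p +++ ?z)"
    by (intro homotopic_paths_join homotopic_paths_cancel_left)
      (use facts in \<open>auto simp: path_image_join\<close>)
  also have "homotopic_paths X \<dots> (p +++ (d +++ (reversepath e +++ reversepath q)))"
    by (intro homotopic_paths_join z) (use facts in auto)
  also have "homotopic_paths X \<dots> ((p +++ d) +++ (reversepath e +++ reversepath q))"
    by (rule homotopic_paths_assoc) (use facts in \<open>auto simp: path_image_join\<close>)
  also have "(p +++ d) +++ (reversepath e +++ reversepath q) = (p +++ d) +++ reversepath (q +++ e)"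
    using facts by (simp add: reversepath_joinpaths)
  finally show ?thesis
    by (rule homotopic_paths_sym)
qed

text \<open>
  By induction on the number of segments: each further one contributes a lasso whose loop stays inside
  a single member of the cover, since both paths do so on that segment.
\<close>

lemma difference_in_spanier_cover_group:
  fixes t :: "nat \<Rightarrow> real"
  assumes \<gamma>: "path \<gamma>" "path_image \<gamma> \<subseteq> X" and g: "path g" "path_image g \<subseteq> X"
    and t: "t 0 = 0" "\<And>i. i \<le> n \<Longrightarrow> t i \<in> {0..1}" "\<And>i. i < n \<Longrightarrow> t i \<le> t (Suc i)"
    and same: "\<And>i. i \<le> n \<Longrightarrow> \<gamma> (t i) = g (t i)"
    and cover: "\<And>i. i < n \<Longrightarrow> \<exists>U\<in>\<U>. \<gamma> ` {t i..t (Suc i)} \<subseteq> U \<and> g ` {t i..t (Suc i)} \<subseteq> U"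
    and "k \<le> n"
  shows "path_class X ((\<gamma> \<circ> linepath 0 (t k)) +++ reversepath (g \<circ> linepath 0 (t k)))
    \<in> spanier_cover_group X \<U> (g 0)"
  using \<open>k \<le> n\<close>
proof (induction k)
  have x: "g 0 \<in> X"
    using g by (auto simp: path_image_def)
  case 0
  have "(\<gamma> \<circ> linepath 0 (t 0)) +++ reversepath (g \<circ> linepath 0 (t 0)) = const_path (g 0)"
    using same[of 0] t(1) by (auto simp: joinpaths_def reversepath_def linepath_def)
  then show ?case
    using subgroup.one_closed[OF subgroup_spanier_cover_group[OF x, of \<U>]]
    by (simp only: fundamental_group_one)
next
  have x: "g 0 \<in> X"
    using g by (auto simp: path_image_def)
  case (Suc k)
  define p q where "p = \<gamma> \<circ> linepath 0 (t k)" and "q = g \<circ> linepath 0 (t k)"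
  define d e where "d = \<gamma> \<circ> linepath (t k) (t (Suc k))" and "e = g \<circ> linepath (t k) (t (Suc k))"
  have k: "k < n" "t k \<in> {0..1}" "t (Suc k) \<in> {0..1}" "t k \<le> t (Suc k)"
    using Suc.prems t by auto
  have start: "\<gamma> 0 = g 0"
    using same[of 0] t(1) by simp
  have ends: "\<gamma> (t k) = g (t k)" "\<gamma> (t (Suc k)) = g (t (Suc k))"
    using same Suc.prems by auto
  have zero: "(0::real) \<in> {0..1}"
    by simp
  note p = path_segment[OF \<gamma> zero k(2), folded p_def]
  note q = path_segment[OF g zero k(2), folded q_def]
  note d = path_segment[OF \<gamma> k(2,3), folded d_def]
  note e = path_segment[OF g k(2,3), folded e_def]
  let ?l = "q +++ (d +++ reversepath e) +++ reversepath q"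
  obtain U where U: "U \<in> \<U>" "\<gamma> ` {t k..t (Suc k)} \<subseteq> U" "g ` {t k..t (Suc k)} \<subseteq> U"
    using cover k(1) by blast
  have "path_image d \<subseteq> U" "path_image e \<subseteq> U"
    using U(2,3) k(4) by (auto simp: d_def e_def path_image_compose closed_segment_eq_real_ivl)
  then have "path_image (d +++ reversepath e) \<subseteq> U"
    using d e ends by (simp add: path_image_join)
  moreover have "q \<in> paths_from X (g 0)"
    using q by (simp add: paths_from_def)
  moreover have "d +++ reversepath e \<in> loops_at X (pathfinish q)"
    using d e q ends by (auto simp: loops_at_def paths_from_def path_image_join)
  ultimately have lasso: "?l \<in> lassos X \<U> (g 0)"
    using U(1) by (auto simp: lassos_def)
  then have "path_class X ?l \<in> spanier_cover_group X \<U> (g 0)"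
    unfolding spanier_cover_group_eq_generate[OF x] by (intro generate.incl imageI)
  moreover have "path_class X (p +++ reversepath q) \<in> spanier_cover_group X \<U> (g 0)"
    unfolding p_def q_def using Suc by (intro Suc.IH) simp
  ultimately have "path_class X (p +++ reversepath q) \<otimes>\<^bsub>fundamental_group X (g 0)\<^esub> path_class X ?l
      \<in> spanier_cover_group X \<U> (g 0)"
    by (rule subgroup.m_closed[OF subgroup_spanier_cover_group[OF x], rotated])
  moreover have "p +++ reversepath q \<in> loops_at X (g 0)"
    using p q start ends by (auto simp: loops_at_def paths_from_def path_image_join)
  moreover have "?l \<in> loops_at X (g 0)"
    using lasso lassos_subset_loops_at by blast
  ultimately have in_S: "path_class X ((p +++ reversepath q) +++ ?l) \<in> spanier_cover_group X \<U> (g 0)"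
    by (simp add: fundamental_group_mult)
  have seg: "{0, t k, t (Suc k)} \<subseteq> {0..1}"
    using k by simp
  have "homotopic_paths X
      ((\<gamma> \<circ> linepath 0 (t (Suc k))) +++ reversepath (g \<circ> linepath 0 (t (Suc k))))
      ((p +++ d) +++ reversepath (q +++ e))"
    unfolding p_def q_def d_def e_def
    using ends
    by (intro homotopic_paths_join homotopic_paths_reversepath_D homotopic_paths_join_segments \<gamma> g seg)
      (simp add: pathfinish_compose)
  also have "homotopic_paths X \<dots> ((p +++ reversepath q) +++ ?l)"
    by (rule homotopic_paths_join_difference) (use p q d e start ends in auto)
  finally show ?case
    using in_S path_class_eqI by metis
qed

lemma quasi_small_loop_group_subset_spanier_group:
  assumes "x \<in> X"
  shows "quasi_small_loop_group X x \<subseteq> spanier_group X x"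
  unfolding spanier_group_def
proof (intro subsetI INT_I)
  fix A \<U> assume "A \<in> quasi_small_loop_group X x" and "\<U> \<in> {\<U>. open_cover X \<U>}"
  then obtain f g where f: "A = path_class X f" "f \<in> loops_at X x" "homotopically_close X f g"
      and null: "homotopic_paths X (const_path x) g" and \<U>: "open_cover X \<U>"
    unfolding quasi_small_loop_group_def path_class_def by blast
  have g: "path g" "path_image g \<subseteq> X" "pathstart g = x"
    using f(2,3) loops_atD[OF f(2)] by (auto simp: homotopically_close_def)
  obtain n where n: "0 < n" "\<And>i. i < n \<Longrightarrow> \<exists>U\<in>\<U>. g ` {real i / real n..real (Suc i) / real n} \<subseteq> U"
    using path_subdivision_open_cover[OF g(1,2) \<U>] by metis
  define t where "t i = real i / real n" for i
  obtain U where U: "\<And>i. i < n \<Longrightarrow> U i \<in> \<U> \<and> g ` {t i..t (Suc i)} \<subseteq> U i"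
    using n(2) unfolding t_def by metis
  have t: "t 0 = 0" "t n = 1" "\<And>i. t i < t (Suc i)" "\<And>i. i \<le> n \<Longrightarrow> t i \<in> {0..1}"
    using n(1) by (auto simp: t_def field_simps)
  have open_U: "openin (top_of_set X) (U i)" if "i < n" for i
    using U[OF that] \<U> by (simp add: open_cover_def)
  obtain \<gamma> where \<gamma>: "path \<gamma>" "path_image \<gamma> \<subseteq> X" "\<forall>i<n. \<gamma> ` {t i..t (Suc i)} \<subseteq> U i"
      "\<forall>i\<le>n. \<gamma> (t i) = g (t i)" "homotopic_paths X \<gamma> f"
    by (rule homotopically_closeE[OF f(3) t(1,2), of U]) (use t(3) U open_U in auto)
  have "path_class X ((\<gamma> \<circ> linepath 0 (t n)) +++ reversepath (g \<circ> linepath 0 (t n)))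
      \<in> spanier_cover_group X \<U> (g 0)"
  proof (rule difference_in_spanier_cover_group[where n = n])
    show "\<exists>U\<in>\<U>. \<gamma> ` {t i..t (Suc i)} \<subseteq> U \<and> g ` {t i..t (Suc i)} \<subseteq> U" if "i < n" for i
      using U[OF that] \<gamma>(3) that by blast
    show "t i \<le> t (Suc i)" for i
      using t(3) by (rule less_imp_le)
  qed (use \<gamma> g t in simp_all)
  then have in_S: "path_class X (\<gamma> +++ reversepath g) \<in> spanier_cover_group X \<U> x"
    using g(3) by (simp add: t(2) linepath_0_1 o_def pathstart_def)
  have "homotopic_paths X (reversepath g) (const_path x)"
    using homotopic_paths_reversepath_D[OF homotopic_paths_sym[OF null]]
    by (simp add: reversepath_def)
  moreover have finish: "pathfinish \<gamma> = x" "pathfinish g = x"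
    using homotopic_paths_imp_pathfinish[OF \<gamma>(5)] loops_atD[OF f(2)] f(3)
    by (auto simp: homotopically_close_def)
  ultimately have "homotopic_paths X (\<gamma> +++ reversepath g) (\<gamma> +++ const_path x)"
    using \<gamma> by (intro homotopic_paths_join) auto
  also have "homotopic_paths X \<dots> \<gamma>"
    using homotopic_paths_join_const[OF \<gamma>(1,2)] finish by simp
  also note \<gamma>(5)
  finally show "A \<in> spanier_cover_group X \<U> x"
    using in_S f(1) path_class_eqI by metis
qed

section \<open>The chain of subgroups\<close>

theorem proposition3p10:
  fixes X :: "'a::topological_space set" and x :: 'a
  assumes "path_connected X" and "x \<in> X"
  shows "subgroup (small_generated_subgroup X x) (fundamental_group X x)
       \<and> subgroup (quasi_small_loop_group X x) (fundamental_group X x)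
       \<and> subgroup (spanier_group X x) (fundamental_group X x)
       \<and> small_generated_subgroup X x \<subseteq> quasi_small_loop_group X x
       \<and> quasi_small_loop_group X x \<subseteq> spanier_group X x"
proof -
  interpret group "fundamental_group X x"
    using assms(2) by (rule group_fundamental_group)
  note qs = subgroup_quasi_small_loop_group[OF assms(2)]
  let ?gens = "{path_class X (\<beta> +++ \<alpha> +++ reversepath \<beta>) | \<beta> \<alpha>.
          \<beta> \<in> paths_from X x \<and> \<alpha> \<in> loops_at X (pathfinish \<beta>) \<and>
          path_class X \<alpha> \<in> small_loop_group X (pathfinish \<beta>)}"
  have gens: "?gens \<subseteq> quasi_small_loop_group X x"
    by (auto intro: small_loop_conjugate_quasi_small)
  then have "?gens \<subseteq> carrier (fundamental_group X x)"
    using subgroup.subset[OF qs] by blast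
  then have "subgroup (small_generated_subgroup X x) (fundamental_group X x)"
    unfolding small_generated_subgroup_def by (rule generate_is_subgroup)
  moreover have "small_generated_subgroup X x \<subseteq> quasi_small_loop_group X x"
    unfolding small_generated_subgroup_def using gens qs by (rule generate_subgroup_incl)
  ultimately show ?thesis
    using qs subgroup_spanier_group[OF assms(2)]
      quasi_small_loop_group_subset_spanier_group[OF assms(2)] by blast
qed

end
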